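(* For every integer $n \geq 6$ with $n \equiv 2 \pmod 4$, the $n$-dimensional simplified shuffle-cube $SSQ_n$ is vertex-pancyclic, i.e. for every vertex $u$ of $SSQ_n$ and every integer $l$ with $3 \leq l \leq |V(SSQ_n)| = 2^{(3n+2)/4}$, there is a cycle of length $l$ in $SSQ_n$ that contains $u$.
   Context: All graphs are finite, simple and undirected. The length of a cycle is its number of edges. Notation for binary strings $u = u_{n-1}u_{n-2}\ldots u_1u_0$: the $4$-prefix is $p_4(u) = u_{n-1}u_{n-2}u_{n-3}u_{n-4}$ and the $(n-4)$-suffix is $s_{n-4}(u) = u_{n-5}\ldots u_1u_0$. The symbol $\oplus$ denotes bitwise addition modulo $2$. Let $V_{00} = \{1111, 0001, 0010, 0011\}$. The simplified shuffle-cube $SSQ_n$ is defined recursively for $n \equiv 2 \pmod 4$, $n \geq 2$; its vertices are certain $n$-bit binary strings. $SSQ_2 = Q_2$ is the $4$-cycle on the strings $00,01,10,11$, two strings being adjacent iff they differ in exactly one bit. For $n > 2$, $SSQ_n$ is obtained from eight copies $SSQ_{n-4}^{i_1i_2i_3i_4}$ of $SSQ_{n-4}$, one for each $i_1i_2i_3i_4$ with $i_1i_2 \in \{00,11\}$ and $i_3,i_4 \in \{0,1\}$; the vertices of $SSQ_{n-4}^{i_1i_2i_3i_4}$ are the strings $u$ with $p_4(u) = i_1i_2i_3i_4$ and $s_{n-4}(u)\in V(SSQ_{n-4})$, and two vertices of the same copy are adjacent iff their $(n-4)$-suffixes are adjacent in $SSQ_{n-4}$. Two vertices $u,v$ in different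 copies are adjacent in $SSQ_n$ iff $s_{n-4}(u) = s_{n-4}(v)$ and $p_4(u) \oplus p_4(v) \in V_{00}$. Thus $SSQ_n$ has $2^{(3n+2)/4}$ vertices. *)

theory Defs
  imports Graph_Theory.Pair_Digraph
begin

text \<open>
  A simple undirected graph is represented as a finite, loop-free, symmetric digraph
  (locale \<open>pair_graph\<close>): the edge \<open>uv\<close> corresponds to the two arcs \<open>(u, v)\<close> and \<open>(v, u)\<close>.

  A binary string \<open>u\<^sub>n\<^sub>-\<^sub>1 \<dots> u\<^sub>1 u\<^sub>0\<close> is a list of booleans whose head is the leading bit
  \<open>u\<^sub>n\<^sub>-\<^sub>1\<close>. So \<open>take 4 u\<close> is the 4-prefix and \<open>drop 4 u\<close> is the (n-4)-suffix of \<open>u\<close>.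
\<close>

definition bit_add :: "bool list \<Rightarrow> bool list \<Rightarrow> bool list" (infixl "\<oplus>\<^sub>2" 65) where
  "u \<oplus>\<^sub>2 v = map2 (\<noteq>) u v"

definition V00 :: "bool list set" where
  "V00 = {[True, True, True, True], [False, False, False, True],
          [False, False, True, False], [False, False, True, True]}"

definition copy_prefixes :: "bool list set" where
  "copy_prefixes = {[i1, i2, i3, i4] | i1 i2 i3 i4.
     [i1, i2] = [False, False] \<or> [i1, i2] = [True, True]}"

definition Q2 :: "bool list pair_pre_digraph" where
  "Q2 = \<lparr> pverts = {u. length u = 2},
          parcs = {(u, v). length u = 2 \<and> length v = 2 \<and> card {i. i < 2 \<and> u ! i \<noteq> v ! i} = 1} \<rparr>"

definition SSQ_step :: "bool list pair_pre_digraph \<Rightarrow> bool list pair_pre_digraph" where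
  "SSQ_step G =
    (let V = {u. take 4 u \<in> copy_prefixes \<and> drop 4 u \<in> pverts G} in
     \<lparr> pverts = V,
       parcs = {(u, v). u \<in> V \<and> v \<in> V \<and>
         (if take 4 u = take 4 v then (drop 4 u, drop 4 v) \<in> parcs G
          else drop 4 u = drop 4 v \<and> take 4 u \<oplus>\<^sub>2 take 4 v \<in> V00)} \<rparr>)"

text \<open>\<open>SSQ n\<close> is meaningful only for \<open>n mod 4 = 2\<close>; for any other \<open>n\<close> it is an empty graph.\<close>

fun SSQ :: "nat \<Rightarrow> bool list pair_pre_digraph" where
  "SSQ n = (if n = 2 then Q2 else if n > 2 then SSQ_step (SSQ (n - 4))
            else \<lparr> pverts = {}, parcs = {} \<rparr>)"

declare SSQ.simps [simp del]

text \<open>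
  \<open>pre_digraph.cycle\<close> takes the list of arcs of a closed walk, so \<open>length p\<close> is the number of
  edges and the tails of the arcs are the vertices of the cycle. The only directed cycles in a
  \<open>pair_graph\<close> that are not cycles of the undirected graph are \<open>u, v, u\<close>, of length 2, and
  these are excluded by \<open>3 \<le> l\<close>.
\<close>

definition vertex_pancyclic :: "'a pair_pre_digraph \<Rightarrow> bool" where
  "vertex_pancyclic G \<longleftrightarrow>
    (\<forall>u \<in> pverts G. \<forall>l. 3 \<le> l \<and> l \<le> card (pverts G) \<longrightarrow>
       (\<exists>p. pre_digraph.cycle (with_proj G) p \<and> length p = l \<and> u \<in> fst ` set p))"

lemma bit_add_commute: "u \<oplus>\<^sub>2 v = v \<oplus>\<^sub>2 u"
  unfolding bit_add_def by (induction u v rule: list_induct2') auto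

lemma pair_graph_Q2: "pair_graph Q2"
proof -
  have fin: "finite {u :: bool list. length u = 2}"
    using finite_lists_length_eq[of "UNIV :: bool set" 2] by simp
  moreover have "finite (parcs Q2)"
    by (rule finite_subset[OF _ finite_cartesian_product[OF fin fin]]) (auto simp: Q2_def)
  moreover have "{i. i < 2 \<and> u ! i \<noteq> v ! i} = {i. i < 2 \<and> v ! i \<noteq> u ! i}" for u v :: "bool list"
    by blast
  then have "sym (parcs Q2)"
    unfolding sym_def Q2_def by simp
  ultimately show ?thesis
    by unfold_locales (auto simp: Q2_def symmetric_def)
qed

lemma pair_graph_SSQ_step:
  assumes "pair_graph G"
  shows "pair_graph (SSQ_step G)"
proof -
  interpret pair_graph G by fact
  have no_loop: "(a, a) \<notin> parcs G" for a
    using pair_no_loops by fastforce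
  let ?V = "{u. take 4 u \<in> copy_prefixes \<and> drop 4 u \<in> pverts G}"
  have "finite copy_prefixes"
    by (rule finite_subset[OF _ finite_lists_length_eq[of "UNIV :: bool set" 4]])
       (auto simp: copy_prefixes_def)
  moreover have "?V \<subseteq> (\<lambda>(x, y). x @ y) ` (copy_prefixes \<times> pverts G)"
  proof
    fix u assume "u \<in> ?V"
    then show "u \<in> (\<lambda>(x, y). x @ y) ` (copy_prefixes \<times> pverts G)"
      by (intro image_eqI[of _ _ "(take 4 u, drop 4 u)"]) simp_all
  qed
  ultimately have fin: "finite ?V"
    using pair_finite_verts by (blast intro: finite_subset)
  have "finite (parcs (SSQ_step G))"
    by (rule finite_subset[OF _ finite_cartesian_product[OF fin fin]]) (auto simp: SSQ_step_def)
  moreover have "sym (parcs G)"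
    using pair_sym_arcs by (simp add: symmetric_def)
  then have "sym (parcs (SSQ_step G))"
    by (auto simp: sym_def SSQ_step_def Let_def bit_add_commute split: if_splits)
  ultimately show ?thesis
    using fin no_loop
    by unfold_locales (auto simp: SSQ_step_def Let_def symmetric_def split: if_splits)
qed

lemma pair_graph_SSQ: "pair_graph (SSQ n)"
proof (induction n rule: SSQ.induct)
  case (1 n)
  moreover have "pair_graph \<lparr> pverts = {}, parcs = {} \<rparr>"
    by unfold_locales (auto simp: symmetric_def sym_def)
  ultimately show ?case
    using pair_graph_Q2 pair_graph_SSQ_step by (subst SSQ.simps) auto
qed

end

theory Submission
  imports Defs
begin

text \<open>
  The eight prefixes form the graph \<open>K\<^sub>4 \<box> K\<^sub>2\<close>, so one recursion step maps \<open>G\<close> to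
  \<open>G \<box> K\<^sub>4 \<box> K\<^sub>2\<close>. Given a Hamiltonian path of \<open>G\<close> that starts in \<open>x\<close>, one finds, by induction
  along this path, paths with any number \<open>l \<in> {2..8\<bar>V(G)\<bar>}\<close> of vertices between two vertices over
  \<open>x\<close> that differ in the last prefix bit: inside the layer over \<open>x\<close>, the numbers up to \<open>8\<close> are
  attained, and for larger \<open>l\<close> an edge of the same kind on a path through \<open>7\<close> or \<open>8\<close> vertices of
  this layer is replaced by a detour through the layers over the rest of the path. Closing such
  paths gives all cycles, and the longest ones are again Hamiltonian paths with any prescribed
  start.
\<close>

text \<open>Only the start is prescribed: the ladder construction returns to the first layer, so the
  far end of the path may be any vertex.\<close>

definition ham_path_from :: "'a pair_pre_digraph \<Rightarrow> 'a \<Rightarrow> 'a list \<Rightarrow> bool" where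
  "ham_path_from G x xs \<longleftrightarrow> successively (\<lambda>u v. (u, v) \<in> parcs G) xs \<and> distinct xs \<and>
     xs \<noteq> [] \<and> hd xs = x \<and> set xs = pverts G"

section \<open>The eight prefixes and the arcs of one recursion step\<close>

definition prefix4 :: "bool \<Rightarrow> bool \<Rightarrow> bool \<Rightarrow> bool list" where
  "prefix4 i j k = [i, i, j, k]"

lemma copy_prefixes_eq: "copy_prefixes = {prefix4 i j k | i j k. True}"
  by (auto simp: copy_prefixes_def prefix4_def)

lemma prefix4_simps [simp]:
  "length (prefix4 i j k) = 4"
  "take 4 (prefix4 i j k @ x) = prefix4 i j k"
  "drop 4 (prefix4 i j k @ x) = x"
  "prefix4 i j k = prefix4 i' j' k' \<longleftrightarrow> i = i' \<and> j = j' \<and> k = k'"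
  "prefix4 i j k @ x = prefix4 i' j' k' @ y \<longleftrightarrow> i = i' \<and> j = j' \<and> k = k' \<and> x = y"
  by (auto simp: prefix4_def numeral_eq_Suc)

text \<open>For fixed \<open>i\<close> this is a \<open>K_4\<close> on the pairs (j, k). Flipping
  \<open>i\<close> forces the sum 1111, so the two copies of \<open>K_4\<close> are joined by a
  perfect matching; complementing j and k in one of them shows the product with
  \<open>K_2\<close>.\<close>

lemma prefix4_add_in_V00:
  "prefix4 i j k \<oplus>\<^sub>2 prefix4 i' j' k' \<in> V00 \<longleftrightarrow>
     (if i = i' then j \<noteq> j' \<or> k \<noteq> k' else j \<noteq> j' \<and> k \<noteq> k')"
  by (auto simp: prefix4_def bit_add_def V00_def)

lemma pverts_SSQ_step:
  "pverts (SSQ_step G) = {prefix4 i j k @ x | i j k x. x \<in> pverts G}"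
proof -
  have "u \<in> {prefix4 i j k @ x | i j k x. x \<in> pverts G}"
    if u: "take 4 u \<in> copy_prefixes" "drop 4 u \<in> pverts G" for u
  proof -
    obtain i j k where "take 4 u = prefix4 i j k"
      using u(1) unfolding copy_prefixes_eq by blast
    then have "u = prefix4 i j k @ drop 4 u"
      by (metis append_take_drop_id)
    then show ?thesis using u(2) by blast
  qed
  then show ?thesis
    by (auto simp: SSQ_step_def Let_def copy_prefixes_eq)
qed

lemma arc_same_layer:
  "(prefix4 i j k @ x, prefix4 i' j' k' @ x) \<in> parcs (SSQ_step G)"
  if "x \<in> pverts G" "if i = i' then j \<noteq> j' \<or> k \<noteq> k' else j \<noteq> j' \<and> k \<noteq> k'"
  using that by (auto simp: SSQ_step_def Let_def copy_prefixes_eq prefix4_add_in_V00)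

lemma arc_same_prefix:
  "(prefix4 i j k @ x, prefix4 i j k @ y) \<in> parcs (SSQ_step G)"
  if "x \<in> pverts G" "y \<in> pverts G" "(x, y) \<in> parcs G"
  using that by (auto simp: SSQ_step_def Let_def copy_prefixes_eq)

lemma card_pverts_SSQ_step: "card (pverts (SSQ_step G)) = 8 * card (pverts G)"
proof -
  let ?f = "\<lambda>((i, j, k), x). prefix4 i j k @ x"
  have "pverts (SSQ_step G) = ?f ` (UNIV \<times> pverts G)"
    unfolding pverts_SSQ_step by (auto simp: image_def Bex_def)
  moreover have "inj_on ?f (UNIV \<times> pverts G)"
    by (auto simp: inj_on_def)
  moreover have "card (UNIV :: (bool \<times> bool \<times> bool) set) = 8"
    by (simp add: card_cartesian_product flip: UNIV_Times_UNIV)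
  ultimately show ?thesis
    by (simp only: card_image card_cartesian_product)
qed

section \<open>Paths between vertices that differ in the last prefix bit\<close>

lemma layer_path:
  assumes "x \<in> pverts G" "2 \<le> l" "l \<le> 8"
  shows "\<exists>ps. successively (\<lambda>u v. (u, v) \<in> parcs (SSQ_step G)) ps \<and> distinct ps \<and> ps \<noteq> [] \<and>
     hd ps = prefix4 i j k @ x \<and> last ps = prefix4 i j (\<not> k) @ x \<and> length ps = l \<and>
     drop 4 ` set ps \<subseteq> {x}"
proof -
  \<comment> \<open>The letters a, b, c, d name the \<open>K_4\<close> of the start vertex, and a
    prime marks the matching partner in the other \<open>K_4\<close>. The witnesses with 7 and 8
    vertices traverse the edge from \<open>?c\<close> to \<open>?d\<close>, the one that a detour
    can replace.\<close>
  let ?p = "\<lambda>i j k. prefix4 i j k @ x"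
  let ?a = "?p i j k" and ?b = "?p i j (\<not> k)" and ?c = "?p i (\<not> j) k" and ?d = "?p i (\<not> j) (\<not> k)"
  let ?a' = "?p (\<not> i) (\<not> j) (\<not> k)" and ?b' = "?p (\<not> i) (\<not> j) k"
    and ?c' = "?p (\<not> i) j (\<not> k)" and ?d' = "?p (\<not> i) j k"
  consider "l = 2" | "l = 3" | "l = 4" | "l = 5" | "l = 6" | "l = 7" | "l = 8"
    using assms by linarith
  then show ?thesis
  proof cases
    case 1 then show ?thesis using assms(1)
      by (intro exI[of _ "[?a, ?b]"]) (simp add: arc_same_layer)
  next
    case 2 then show ?thesis using assms(1)
      by (intro exI[of _ "[?a, ?c, ?b]"]) (simp add: arc_same_layer)
  next
    case 3 then show ?thesis using assms(1)
      by (intro exI[of _ "[?a, ?c, ?d, ?b]"]) (simp add: arc_same_layer)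
  next
    case 4 then show ?thesis using assms(1)
      by (intro exI[of _ "[?a, ?a', ?c', ?b', ?b]"]) (simp add: arc_same_layer)
  next
    case 5 then show ?thesis using assms(1)
      by (intro exI[of _ "[?a, ?c, ?d, ?d', ?b', ?b]"]) (simp add: arc_same_layer)
  next
    case 6 then show ?thesis using assms(1)
      by (intro exI[of _ "[?a, ?c, ?d, ?d', ?c', ?b', ?b]"]) (simp add: arc_same_layer)
  next
    case 7 then show ?thesis using assms(1)
      by (intro exI[of _ "[?a, ?c, ?d, ?d', ?c', ?a', ?b', ?b]"]) (simp add: arc_same_layer)
  qed
qed

lemma ladder_path:
  assumes "successively (\<lambda>u v. (u, v) \<in> parcs G) (x # xs)" "sym (parcs G)"
    and "distinct (x # xs)" "set (x # xs) \<subseteq> pverts G" "2 \<le> l" "l \<le> 8 * length (x # xs)"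
  shows "\<exists>ps. successively (\<lambda>u v. (u, v) \<in> parcs (SSQ_step G)) ps \<and> distinct ps \<and> ps \<noteq> [] \<and>
     hd ps = prefix4 i j k @ x \<and> last ps = prefix4 i j (\<not> k) @ x \<and> length ps = l \<and>
     drop 4 ` set ps \<subseteq> set (x # xs)"
  using assms
\<comment> \<open>The bits and \<open>l\<close> are generalised because the detour starts over
  \<open>y\<close> with \<open>j\<close> negated and has its own number of vertices.\<close>
proof (induction xs arbitrary: x i j k l)
  case Nil
  then show ?case using layer_path[of x G l i j k] by simp
next
  case (Cons y ys)
  have x: "x \<in> pverts G" and y: "y \<in> pverts G" and xy: "(x, y) \<in> parcs G" "(y, x) \<in> parcs G"
    using Cons.prems by (auto dest: symD)
  show ?case
  proof (cases "l \<le> 8")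
    case True
    then obtain ps where "successively (\<lambda>u v. (u, v) \<in> parcs (SSQ_step G)) ps" "distinct ps"
      "ps \<noteq> []" "hd ps = prefix4 i j k @ x" "last ps = prefix4 i j (\<not> k) @ x" "length ps = l"
      "drop 4 ` set ps \<subseteq> {x}"
      using layer_path[OF x Cons.prems(5), of i j k] by blast
    then show ?thesis by (intro exI[of _ ps]) auto
  next
    case False
    let ?p = "\<lambda>i j k. prefix4 i j k @ x"
    let ?a = "?p i j k" and ?b = "?p i j (\<not> k)" and ?c = "?p i (\<not> j) k"
      and ?d = "?p i (\<not> j) (\<not> k)"
    let ?a' = "?p (\<not> i) (\<not> j) (\<not> k)" and ?b' = "?p (\<not> i) (\<not> j) k"
      and ?c' = "?p (\<not> i) j (\<not> k)" and ?d' = "?p (\<not> i) j k"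
    \<comment> \<open>No detour has a single vertex, so \<open>l = 9\<close> needs the layer path with seven vertices.\<close>
    define m where "m = (if l = 9 then 2 else l - 8)"
    define ts where "ts = (if l = 9 then [?d, ?d', ?c', ?b', ?b] else [?d, ?d', ?c', ?a', ?b', ?b])"
    have m: "2 \<le> m" "m \<le> 8 * length (y # ys)" "l = 2 + m + length ts"
      using False Cons.prems(5,6) by (auto simp: m_def ts_def)
    obtain qs where qs: "successively (\<lambda>u v. (u, v) \<in> parcs (SSQ_step G)) qs" "distinct qs"
      "qs \<noteq> []" "hd qs = prefix4 i (\<not> j) k @ y" "last qs = prefix4 i (\<not> j) (\<not> k) @ y"
      "length qs = m" "drop 4 ` set qs \<subseteq> set (y # ys)"
      using Cons.IH[of y m i "\<not> j" k] Cons.prems(1-4) m(1,2) by auto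
    have ts: "successively (\<lambda>u v. (u, v) \<in> parcs (SSQ_step G)) ts" "distinct (?a # ?c # ts)"
      "ts \<noteq> []" "hd ts = ?d" "last ts = ?b" "drop 4 ` set ts \<subseteq> {x}"
      using x by (simp_all add: ts_def arc_same_layer)
    \<comment> \<open>The suffixes separate the two pieces: one lies over \<open>x\<close>, the
      other over \<open>y # ys\<close>, and the list is distinct.\<close>
    have "drop 4 ` set (?a # ?c # ts) \<inter> drop 4 ` set qs = {}"
      using ts(6) qs(7) Cons.prems(3) by auto
    then have "set (?a # ?c # ts) \<inter> set qs = {}"
      by blast
    then have "distinct (?a # ?c # qs @ ts)"
      using ts(2) qs(2) by auto
    \<comment> \<open>The layers are joined twice: at \<open>?c\<close> by the arc from
      \<open>x\<close> to \<open>y\<close>, and at \<open>?d\<close> by the reverse arc, which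
      symmetry supplies.\<close>
    moreover have "successively (\<lambda>u v. (u, v) \<in> parcs (SSQ_step G)) (?a # ?c # qs @ ts)"
      using qs ts x y xy
      by (simp add: successively_append_iff successively_Cons arc_same_layer arc_same_prefix)
    ultimately show ?thesis
      using qs ts m(3) by (intro exI[of _ "?a # ?c # qs @ ts"]) auto
  qed
qed

section \<open>Closing a vertex list to a cycle\<close>

text \<open>The \<open>zip\<close> pairs each vertex of the walk \<open>x # xs @ [y]\<close> with
  its successor, so it is the arc list of this walk.\<close>

lemma cas_zip:
  "pre_digraph.cas (with_proj G) x (zip (x # xs) (xs @ [y])) y"
proof (induction xs arbitrary: x)
  case Nil
  show ?case by (simp add: pre_digraph.cas.simps)
next
  case (Cons z zs)
  then show ?case by (simp add: pre_digraph.cas.simps)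
qed

lemma awalk_verts_zip:
  "pre_digraph.awalk_verts (with_proj G) x (zip (x # xs) (xs @ [y])) = x # xs @ [y]"
  by (induction xs arbitrary: x) (simp_all add: pre_digraph.awalk_verts.simps)

lemma set_zip_successively:
  "successively (\<lambda>u v. (u, v) \<in> A) (x # xs) \<Longrightarrow> (last (x # xs), y) \<in> A \<Longrightarrow>
   set (zip (x # xs) (xs @ [y])) \<subseteq> A"
  by (induction xs arbitrary: x) auto

lemma cycle_of_path:
  assumes "successively (\<lambda>u v. (u, v) \<in> parcs G) (x # xs)" "(last (x # xs), x) \<in> parcs G"
    and "distinct (x # xs)" "x \<in> pverts G"
  shows "\<exists>p. pre_digraph.cycle (with_proj G) p \<and> length p = length (x # xs) \<and> x \<in> fst ` set p"
proof -
  let ?p = "zip (x # xs) (xs @ [x])"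
  have "pre_digraph.awalk (with_proj G) x ?p x"
    using set_zip_successively[OF assms(1,2)] assms(4) cas_zip
    by (simp add: pre_digraph.awalk_def)
  \<comment> \<open>A cycle requires distinctness of the vertex list without its head, here
    \<open>xs @ [x]\<close>, a rearrangement of \<open>x # xs\<close>.\<close>
  then have "pre_digraph.cycle (with_proj G) ?p"
    using assms(3) by (auto simp: pre_digraph.cycle_def awalk_verts_zip)
  moreover have "x \<in> fst ` set ?p"
    by (cases xs) auto
  ultimately show ?thesis
    by (intro exI[of _ ?p]) simp
qed

section \<open>Cycles and Hamiltonian paths after one recursion step\<close>

text \<open>Used twice: for \<open>l \<ge> 3\<close> the path closes to a cycle through
  \<open>u\<close>, and for the largest \<open>l\<close> it is a Hamiltonian path. It closes because
  its ends differ only in the last prefix bit.\<close>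

lemma path_SSQ_step:
  assumes G: "pair_graph G" and ham: "\<forall>x \<in> pverts G. \<exists>xs. ham_path_from G x xs"
    and u: "u \<in> pverts (SSQ_step G)" and l: "2 \<le> l" "l \<le> card (pverts (SSQ_step G))"
  shows "\<exists>us. successively (\<lambda>u v. (u, v) \<in> parcs (SSQ_step G)) (u # us) \<and> distinct (u # us) \<and>
     (last (u # us), u) \<in> parcs (SSQ_step G) \<and> length (u # us) = l"
proof -
  interpret G: pair_graph G by fact
  obtain i j k x where ux: "u = prefix4 i j k @ x" "x \<in> pverts G"
    using u by (auto simp: pverts_SSQ_step)
  obtain xs where xs: "ham_path_from G x (x # xs)"
    using ham ux(2) unfolding ham_path_from_def by (metis list.collapse)
  \<comment> \<open>A ladder over a Hamiltonian path has \<open>8 * card (pverts G)\<close>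
    vertices, so its range of \<open>l\<close> reaches the order of the new graph.\<close>
  then have "card (pverts G) = length (x # xs)"
    unfolding ham_path_from_def by (metis distinct_card)
  moreover have "sym (parcs G)"
    using G.pair_sym_arcs by (simp add: symmetric_def)
  ultimately obtain ps where ps: "successively (\<lambda>u v. (u, v) \<in> parcs (SSQ_step G)) ps"
    "distinct ps" "ps \<noteq> []" "hd ps = u" "last ps = prefix4 i j (\<not> k) @ x" "length ps = l"
    using ladder_path[of G x xs l i j k] xs l ux
    by (auto simp: ham_path_from_def card_pverts_SSQ_step)
  moreover have "(last ps, u) \<in> parcs (SSQ_step G)"
    using ps(5) ux by (simp add: arc_same_layer)
  moreover have "u # tl ps = ps"
    using ps(3,4) by auto
  ultimately show ?thesis
    by (intro exI[of _ "tl ps"]) simp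
qed

lemma vertex_pancyclic_SSQ_step:
  assumes "pair_graph G" "\<forall>x \<in> pverts G. \<exists>xs. ham_path_from G x xs"
  shows "vertex_pancyclic (SSQ_step G)"
  unfolding vertex_pancyclic_def
proof (intro ballI allI impI)
  fix u l assume "u \<in> pverts (SSQ_step G)" "3 \<le> l \<and> l \<le> card (pverts (SSQ_step G))"
  then obtain us where us: "successively (\<lambda>u v. (u, v) \<in> parcs (SSQ_step G)) (u # us)"
    "distinct (u # us)" "(last (u # us), u) \<in> parcs (SSQ_step G)" "length (u # us) = l"
    using path_SSQ_step[OF assms, of u l] by auto
  show "\<exists>p. pre_digraph.cycle (with_proj (SSQ_step G)) p \<and> length p = l \<and> u \<in> fst ` set p"
    using cycle_of_path[OF us(1,3,2) \<open>u \<in> pverts (SSQ_step G)\<close>] us(4) by simp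
qed

text \<open>A path with as many distinct vertices as the graph has must visit all of them.\<close>

lemma ham_path_SSQ_step:
  assumes "pair_graph G" "\<forall>x \<in> pverts G. \<exists>xs. ham_path_from G x xs"
    and u: "u \<in> pverts (SSQ_step G)"
  shows "\<exists>us. ham_path_from (SSQ_step G) u us"
proof -
  interpret S: pair_graph "SSQ_step G"
    by (rule pair_graph_SSQ_step) fact
  have "0 < card (pverts (SSQ_step G))"
    using u by (auto simp: card_gt_0_iff)
  then have "2 \<le> card (pverts (SSQ_step G))"
    by (simp add: card_pverts_SSQ_step)
  then obtain us where us: "successively (\<lambda>u v. (u, v) \<in> parcs (SSQ_step G)) (u # us)"
    "distinct (u # us)" "length (u # us) = card (pverts (SSQ_step G))"
    using path_SSQ_step[OF assms, of "card (pverts (SSQ_step G))"] by auto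
  have "set vs \<subseteq> pverts (SSQ_step G)"
    if "successively (\<lambda>u v. (u, v) \<in> parcs (SSQ_step G)) (v # vs)" for v vs
    using that by (induction vs arbitrary: v) (auto dest: S.in_arcsD2)
  then have "set (u # us) \<subseteq> pverts (SSQ_step G)"
    using us(1) u by simp
  moreover have "card (set (u # us)) = card (pverts (SSQ_step G))"
    using distinct_card[OF us(2)] us(3) by simp
  ultimately have "set (u # us) = pverts (SSQ_step G)"
    by (intro card_subset_eq) simp_all
  then show ?thesis
    using us unfolding ham_path_from_def by (intro exI[of _ "u # us"]) simp
qed

section \<open>The 4-cycle as base case, and induction on the number of steps\<close>

lemma pverts_Q2: "pverts Q2 = {[i, j] | i j. True}"
  by (auto simp: Q2_def numeral_2_eq_2 length_Suc_conv)

lemma arc_Q2: "([i, j], [i', j']) \<in> parcs Q2" if "(i = i') \<noteq> (j = j')"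
proof -
  have "{n. n < 2 \<and> [i, j] ! n \<noteq> [i', j'] ! n} = (if i = i' then {1} else {0})"
    using that by (auto simp: less_2_cases_iff)
  then show ?thesis by (simp add: Q2_def)
qed

lemma ham_path_Q2:
  assumes "u \<in> pverts Q2"
  shows "\<exists>us. ham_path_from Q2 u us"
proof -
  obtain i j where "u = [i, j]" using assms by (auto simp: pverts_Q2)
  then have "ham_path_from Q2 u [[i, j], [\<not> i, j], [\<not> i, \<not> j], [i, \<not> j]]"
    by (auto simp: ham_path_from_def arc_Q2 pverts_Q2)
  then show ?thesis by blast
qed

lemma SSQ_Suc: "SSQ (4 * Suc q + 2) = SSQ_step (SSQ (4 * q + 2))"
  by (subst SSQ.simps) simp

lemma ham_path_SSQ: "\<forall>u \<in> pverts (SSQ (4 * q + 2)). \<exists>us. ham_path_from (SSQ (4 * q + 2)) u us"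
proof (induction q)
  case 0
  then show ?case using ham_path_Q2 by (simp add: SSQ.simps)
next
  case (Suc q)
  then show ?case
    unfolding SSQ_Suc using ham_path_SSQ_step[OF pair_graph_SSQ] by blast
qed

lemma card_pverts_SSQ: "card (pverts (SSQ (4 * q + 2))) = 2 ^ (3 * q + 2)"
proof (induction q)
  case 0
  have "card {u :: bool list. length u = 2} = 4"
    using card_lists_length_eq[of "UNIV :: bool set" 2] by simp
  then show ?case by (simp add: SSQ.simps Q2_def)
next
  case (Suc q)
  then show ?case
    unfolding SSQ_Suc card_pverts_SSQ_step by (simp add: power_add)
qed

theorem theorem6:
  fixes n :: nat
  assumes "n \<ge> 6" and "n mod 4 = 2"
  shows "vertex_pancyclic (SSQ n) \<and> card (pverts (SSQ n)) = 2 ^ ((3 * n + 2) div 4)"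
proof -
  \<comment> \<open>Since \<open>n \<ge> 6\<close>, at least one step is applied. This matters for
    \<open>l = 3\<close>, as the 4-cycle \<open>Q2\<close> has no triangle; from level
    \<open>q\<close> only Hamiltonian paths are taken.\<close>
  define q where "q = n div 4 - 1"
  have n: "n = 4 * Suc q + 2"
    using assms unfolding q_def by presburger
  have "vertex_pancyclic (SSQ n)"
    unfolding n SSQ_Suc by (rule vertex_pancyclic_SSQ_step[OF pair_graph_SSQ ham_path_SSQ])
  moreover have "(3 * n + 2) div 4 = 3 * Suc q + 2"
    unfolding n by simp
  then have "card (pverts (SSQ n)) = 2 ^ ((3 * n + 2) div 4)"
    using card_pverts_SSQ[of "Suc q"] n by simp
  ultimately show ?thesis ..
qed

end
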